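(* Let $k$ be a field, $G$ a group, and let $V$ and $W$ be finite dimensional $G$-graded $k$-vector spaces. Then the $G$-graded algebras $\mathrm{END}(V)$ and $\mathrm{END}(W)$ are isomorphic (as $G$-graded $k$-algebras) if and only if there exists $\sigma\in G$ such that $W\simeq V(\sigma)$ as $G$-graded vector spaces.
   Context: A $G$-graded $k$-vector space is a $k$-vector space with a decomposition $V=\bigoplus_{g\in G}V_g$ into subspaces; an isomorphism of $G$-graded vector spaces is a linear isomorphism mapping each degree-$g$ component onto the degree-$g$ component. A $G$-graded $k$-algebra is a $k$-algebra $A=\bigoplus_{g\in G}A_g$ (direct sum of subspaces) with $A_gA_h\subseteq A_{gh}$ for all $g,h\in G$; an isomorphism of $G$-graded algebras is an algebra isomorphism mapping each $A_g$ onto the corresponding degree-$g$ component. For $\sigma\in G$, the (left) $\sigma$-suspension $V(\sigma)$ is the vector space $V$ with the grading $V(\sigma)_g=V_{g\sigma}$ for $g\in G$. For $\sigma\in G$ put $\mathrm{END}(V)_\sigma=\{f\in\mathrm{End}_k(V)\mid f(V_g)\subseteq V_{\sigma g}\text{ for all }g\in G\}$; then $\mathrm{END}(V)=\bigoplus_{\sigma\in G}\mathrm{END}(V)_\sigma$ is a $G$-graded algebra under composition, equal to $\mathrm{End}_k(V)$ as an algebra when $V$ is finite dimensional. *)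

theory Defs
  imports Complex_Main "HOL-Library.Function_Algebras"
begin

(* The grading group is a type of class group_add. This class does not assume commutativity;
   the group operation is written additively, so that g + h stands for the product gh
   (in this order) and 0 for the neutral element. *)

definition is_decomposition :: "('g \<Rightarrow> 'a::ab_group_add set) \<Rightarrow> 'a \<Rightarrow> ('g \<Rightarrow> 'a) \<Rightarrow> bool" where
  "is_decomposition A v u \<longleftrightarrow>
     (\<forall>g. u g \<in> A g) \<and> finite {g. u g \<noteq> 0} \<and> v = (\<Sum>g | u g \<noteq> 0. u g)"

definition sum_of_components :: "('g \<Rightarrow> 'a::ab_group_add set) \<Rightarrow> 'a set" where
  "sum_of_components A = {v. \<exists>u. is_decomposition A v u}"

(* The sum of the A g inside the ambient space is direct, but need not be the whole space:
   END(V) lives inside the space of all functions on V. *)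
locale direct_sum_of_subspaces = vector_space scale
  for scale :: "'k::field \<Rightarrow> 'a::ab_group_add \<Rightarrow> 'a" +
  fixes A :: "'g \<Rightarrow> 'a set"
  assumes subspace_component: "subspace (A g)"
    and decomposition_unique: "is_decomposition A v u \<Longrightarrow> is_decomposition A v u' \<Longrightarrow> u = u'"

locale graded_vector_space = direct_sum_of_subspaces scale V
  for scale :: "'k::field \<Rightarrow> 'a::ab_group_add \<Rightarrow> 'a" and V :: "'g::group_add \<Rightarrow> 'a set" +
  assumes sum_of_components_UNIV: "sum_of_components V = UNIV"

definition finite_dimensional :: "('k::field \<Rightarrow> 'a::ab_group_add \<Rightarrow> 'a) \<Rightarrow> bool" where
  "finite_dimensional scale \<longleftrightarrow> (\<exists>B. finite_dimensional_vector_space scale B)"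

definition suspension :: "('g::group_add \<Rightarrow> 'a set) \<Rightarrow> 'g \<Rightarrow> 'g \<Rightarrow> 'a set" where
  "suspension V \<sigma> = (\<lambda>g. V (g + \<sigma>))"

definition graded_vector_space_iso ::
  "('k::field \<Rightarrow> 'a::ab_group_add \<Rightarrow> 'a) \<Rightarrow> ('g::group_add \<Rightarrow> 'a set) \<Rightarrow>
   ('k \<Rightarrow> 'b::ab_group_add \<Rightarrow> 'b) \<Rightarrow> ('g \<Rightarrow> 'b set) \<Rightarrow> ('a \<Rightarrow> 'b) \<Rightarrow> bool" where
  "graded_vector_space_iso scaleV V scaleW W f \<longleftrightarrow>
     Vector_Spaces.linear scaleV scaleW f \<and> bij f \<and> (\<forall>g. f ` V g = W g)"

definition graded_vector_spaces_isomorphic ::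
  "('k::field \<Rightarrow> 'a::ab_group_add \<Rightarrow> 'a) \<Rightarrow> ('g::group_add \<Rightarrow> 'a set) \<Rightarrow>
   ('k \<Rightarrow> 'b::ab_group_add \<Rightarrow> 'b) \<Rightarrow> ('g \<Rightarrow> 'b set) \<Rightarrow> bool" where
  "graded_vector_spaces_isomorphic scaleV V scaleW W \<longleftrightarrow>
     (\<exists>f. graded_vector_space_iso scaleV V scaleW W f)"

(* Addition and zero are those of the ambient type 'a; the underlying set of the algebra is
   the sum of its homogeneous components. *)
record ('g, 'k, 'a) graded_alg =
  alg_component :: "'g \<Rightarrow> 'a set"
  alg_scale :: "'k \<Rightarrow> 'a \<Rightarrow> 'a"
  alg_mult :: "'a \<Rightarrow> 'a \<Rightarrow> 'a"
  alg_one :: 'a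

definition alg_carrier :: "('g, 'k, 'a::ab_group_add) graded_alg \<Rightarrow> 'a set" where
  "alg_carrier R = sum_of_components (alg_component R)"

locale graded_algebra = direct_sum_of_subspaces "alg_scale R" "alg_component R"
  for R :: "('g::group_add, 'k::field, 'a::ab_group_add) graded_alg" +
  assumes mult_component:
      "\<lbrakk>x \<in> alg_component R g; y \<in> alg_component R h\<rbrakk> \<Longrightarrow> alg_mult R x y \<in> alg_component R (g + h)"
    and mult_assoc:
      "\<lbrakk>x \<in> alg_carrier R; y \<in> alg_carrier R; z \<in> alg_carrier R\<rbrakk> \<Longrightarrow>
       alg_mult R (alg_mult R x y) z = alg_mult R x (alg_mult R y z)"
    and mult_add_left:
      "\<lbrakk>x \<in> alg_carrier R; y \<in> alg_carrier R; z \<in> alg_carrier R\<rbrakk> \<Longrightarrow>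
       alg_mult R (x + y) z = alg_mult R x z + alg_mult R y z"
    and mult_add_right:
      "\<lbrakk>x \<in> alg_carrier R; y \<in> alg_carrier R; z \<in> alg_carrier R\<rbrakk> \<Longrightarrow>
       alg_mult R x (y + z) = alg_mult R x y + alg_mult R x z"
    and mult_scale_left:
      "\<lbrakk>x \<in> alg_carrier R; y \<in> alg_carrier R\<rbrakk> \<Longrightarrow>
       alg_mult R (alg_scale R c x) y = alg_scale R c (alg_mult R x y)"
    and mult_scale_right:
      "\<lbrakk>x \<in> alg_carrier R; y \<in> alg_carrier R\<rbrakk> \<Longrightarrow>
       alg_mult R x (alg_scale R c y) = alg_scale R c (alg_mult R x y)"
    and one_carrier: "alg_one R \<in> alg_carrier R"
    and one_left: "x \<in> alg_carrier R \<Longrightarrow> alg_mult R (alg_one R) x = x"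
    and one_right: "x \<in> alg_carrier R \<Longrightarrow> alg_mult R x (alg_one R) = x"

(* Only the values of phi on the underlying set of R matter. *)
definition graded_algebra_iso ::
  "('g::group_add, 'k::field, 'a::ab_group_add) graded_alg \<Rightarrow>
   ('g, 'k, 'b::ab_group_add) graded_alg \<Rightarrow> ('a \<Rightarrow> 'b) \<Rightarrow> bool" where
  "graded_algebra_iso R S \<phi> \<longleftrightarrow>
     bij_betw \<phi> (alg_carrier R) (alg_carrier S) \<and>
     (\<forall>x\<in>alg_carrier R. \<forall>y\<in>alg_carrier R. \<phi> (x + y) = \<phi> x + \<phi> y) \<and>
     (\<forall>c. \<forall>x\<in>alg_carrier R. \<phi> (alg_scale R c x) = alg_scale S c (\<phi> x)) \<and>
     (\<forall>x\<in>alg_carrier R. \<forall>y\<in>alg_carrier R. \<phi> (alg_mult R x y) = alg_mult S (\<phi> x) (\<phi> y)) \<and>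
     \<phi> (alg_one R) = alg_one S \<and>
     (\<forall>g. \<phi> ` alg_component R g = alg_component S g)"

definition graded_algebras_isomorphic ::
  "('g::group_add, 'k::field, 'a::ab_group_add) graded_alg \<Rightarrow>
   ('g, 'k, 'b::ab_group_add) graded_alg \<Rightarrow> bool" where
  "graded_algebras_isomorphic R S \<longleftrightarrow> (\<exists>\<phi>. graded_algebra_iso R S \<phi>)"

definition END_component ::
  "('k::field \<Rightarrow> 'a::ab_group_add \<Rightarrow> 'a) \<Rightarrow> ('g::group_add \<Rightarrow> 'a set) \<Rightarrow> 'g \<Rightarrow> ('a \<Rightarrow> 'a) set" where
  "END_component scale V \<sigma> =
     {f. Vector_Spaces.linear scale scale f \<and> (\<forall>g. f ` V g \<subseteq> V (\<sigma> + g))}"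

definition END ::
  "('k::field \<Rightarrow> 'a::ab_group_add \<Rightarrow> 'a) \<Rightarrow> ('g::group_add \<Rightarrow> 'a set) \<Rightarrow>
   ('g, 'k, 'a \<Rightarrow> 'a) graded_alg" where
  "END scale V =
     \<lparr>alg_component = END_component scale V,
      alg_scale = (\<lambda>c f x. scale c (f x)),
      alg_mult = (\<circ>),
      alg_one = id\<rparr>"

lemma END_simps [simp]:
  "alg_component (END scale V) = END_component scale V"
  "alg_scale (END scale V) c f = (\<lambda>x. scale c (f x))"
  "alg_mult (END scale V) f h = f \<circ> h"
  "alg_one (END scale V) = id"
  by (simp_all add: END_def)

lemma sum_fun_apply: "(\<Sum>i\<in>I. f i) x = (\<Sum>i\<in>I. f i x)"
  by (induction I rule: infinite_finite_induct) auto

lemma component_subset_sum: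
  assumes "x \<in> A g" and "\<And>h. 0 \<in> A h"
  shows "x \<in> sum_of_components A"
proof -
  define u where "u = (\<lambda>h. if h = g then x else 0)"
  have supp: "{h. u h \<noteq> 0} = (if x = 0 then {} else {g})" by (auto simp: u_def)
  have "is_decomposition A x u"
    unfolding is_decomposition_def supp using assms by (auto simp: u_def)
  then show ?thesis by (auto simp: sum_of_components_def)
qed

context graded_vector_space
begin

lemma linear_sum_fun:
  assumes "\<And>i. i \<in> I \<Longrightarrow> Vector_Spaces.linear scale scale (f i)"
  shows "Vector_Spaces.linear scale scale (\<Sum>i\<in>I. f i)"
proof -
  interpret vector_space_pair scale scale by unfold_locales
  have "(\<Sum>i\<in>I. f i) = (\<lambda>x. \<Sum>i\<in>I. f i x)" by (rule ext) (simp add: sum_fun_apply)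
  then show ?thesis using linear_compose_sum[of I f] assms by auto
qed

lemma END_carrier_linear:
  assumes "f \<in> alg_carrier (END scale V)"
  shows "Vector_Spaces.linear scale scale f"
proof -
  obtain u where u: "is_decomposition (END_component scale V) f u"
    using assms by (auto simp: alg_carrier_def sum_of_components_def)
  have "Vector_Spaces.linear scale scale (\<Sum>\<tau> | u \<tau> \<noteq> 0. u \<tau>)"
    using u by (intro linear_sum_fun) (auto simp: is_decomposition_def END_component_def)
  then show ?thesis using u by (simp add: is_decomposition_def)
qed

lemma linear_eqI:
  assumes "Vector_Spaces.linear scale scale f" "Vector_Spaces.linear scale scale f'"
    and eq: "\<And>g v. v \<in> V g \<Longrightarrow> f v = f' v"
  shows "f = f'"
proof
  fix v
  obtain u where u: "is_decomposition V v u"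
    using sum_of_components_UNIV by (auto simp: sum_of_components_def)
  interpret f: Vector_Spaces.linear scale scale f by fact
  interpret f': Vector_Spaces.linear scale scale f' by fact
  show "f v = f' v"
    using u eq by (auto simp: is_decomposition_def f.sum f'.sum intro!: sum.cong)
qed

lemma decomposition_apply:
  assumes u: "is_decomposition (END_component scale V) f u" and v: "v \<in> V g"
  shows "is_decomposition V (f v) (\<lambda>\<tau>. u (\<tau> - g) v)"
proof -
  have fin: "finite {\<tau>. u \<tau> \<noteq> 0}" using u by (simp add: is_decomposition_def)
  have sub: "{\<tau>. u (\<tau> - g) v \<noteq> 0} \<subseteq> (\<lambda>\<tau>. \<tau> + g) ` {\<tau>. u \<tau> \<noteq> 0}"
  proof
    fix \<tau> assume "\<tau> \<in> {\<tau>. u (\<tau> - g) v \<noteq> 0}"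
    then have "u (\<tau> - g) \<noteq> 0" by auto
    then show "\<tau> \<in> (\<lambda>\<tau>. \<tau> + g) ` {\<tau>. u \<tau> \<noteq> 0}"
      by (intro image_eqI[of _ _ "\<tau> - g"]) auto
  qed
  have "f v = (\<Sum>\<tau> | u \<tau> \<noteq> 0. u \<tau> v)"
    using u by (simp add: is_decomposition_def sum_fun_apply)
  also have "\<dots> = (\<Sum>\<tau>\<in>(\<lambda>\<tau>. \<tau> + g) ` {\<tau>. u \<tau> \<noteq> 0}. u (\<tau> - g) v)"
    by (subst sum.reindex) (auto simp: inj_on_def)
  also have "\<dots> = (\<Sum>\<tau> | u (\<tau> - g) v \<noteq> 0. u (\<tau> - g) v)"
    using sub fin by (intro sum.mono_neutral_right) auto
  finally have eq: "f v = (\<Sum>\<tau> | u (\<tau> - g) v \<noteq> 0. u (\<tau> - g) v)" .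
  have mem: "u (\<tau> - g) v \<in> V \<tau>" for \<tau>
  proof -
    have "u (\<tau> - g) ` V g \<subseteq> V (\<tau> - g + g)"
      using u unfolding is_decomposition_def END_component_def by blast
    then show ?thesis using v by auto
  qed
  have "finite {\<tau>. u (\<tau> - g) v \<noteq> 0}" using sub fin finite_subset by blast
  with eq mem show ?thesis unfolding is_decomposition_def by blast
qed

lemma END_direct: "direct_sum_of_subspaces (alg_scale (END scale V)) (alg_component (END scale V))"
proof -
  interpret vp: vector_space_pair scale scale by unfold_locales
  interpret F: vector_space "\<lambda>c f x. scale c (f x)"
    by unfold_locales (auto simp: fun_eq_iff scale_right_distrib scale_left_distrib)
  have sc: "alg_scale (END scale V) = (\<lambda>c f x. scale c (f x))" by (simp add: END_def)
  show ?thesis unfolding sc END_simps(1)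
  proof (unfold_locales, goal_cases)
    case (1 \<sigma>)
    have add: "x \<in> V g' \<Longrightarrow> y \<in> V g' \<Longrightarrow> x + y \<in> V g'" for x y g'
      using subspace_component subspace_add by blast
    have z: "0 \<in> V g'" for g' using subspace_component subspace_0 by blast
    have scl: "x \<in> V g' \<Longrightarrow> scale c x \<in> V g'" for x g' c
      using subspace_component subspace_scale by blast
    show ?case
    proof (rule F.subspaceI)
      show "0 \<in> END_component scale V \<sigma>"
        using vp.linear_zero z by (auto simp: END_component_def zero_fun_def)
    next
      fix f h assume fh: "f \<in> END_component scale V \<sigma>" "h \<in> END_component scale V \<sigma>"
      have "Vector_Spaces.linear scale scale (f + h)"
        using fh vp.linear_compose_add[of f h] by (simp add: END_component_def plus_fun_def)
      moreover have "(f + h) x \<in> V (\<sigma> + g)" if "x \<in> V g" for x g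
      proof -
        have "f x \<in> V (\<sigma> + g)" "h x \<in> V (\<sigma> + g)"
          using fh that unfolding END_component_def by blast+
        then show ?thesis by (simp add: add)
      qed
      ultimately show "f + h \<in> END_component scale V \<sigma>"
        unfolding END_component_def by blast
    next
      fix c f assume f: "f \<in> END_component scale V \<sigma>"
      have "Vector_Spaces.linear scale scale (\<lambda>x. scale c (f x))"
        using f vp.linear_compose_scale_right[of f c] by (simp add: END_component_def)
      moreover have "scale c (f x) \<in> V (\<sigma> + g)" if "x \<in> V g" for x g
      proof -
        have "f x \<in> V (\<sigma> + g)"
          using f that unfolding END_component_def by blast
        then show ?thesis by (rule scl)
      qed
      ultimately show "(\<lambda>x. scale c (f x)) \<in> END_component scale V \<sigma>"
        unfolding END_component_def by blast
    qed
  next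
    case (2 f u u')
    show ?case
    proof
      fix \<sigma>
      show "u \<sigma> = u' \<sigma>"
      proof (rule linear_eqI)
        show "Vector_Spaces.linear scale scale (u \<sigma>)" "Vector_Spaces.linear scale scale (u' \<sigma>)"
          using 2 by (auto simp: is_decomposition_def END_component_def)
        fix g v assume "v \<in> V g"
        then have "(\<lambda>\<tau>. u (\<tau> - g) v) = (\<lambda>\<tau>. u' (\<tau> - g) v)"
          using 2 decomposition_apply decomposition_unique by blast
        then have "u (\<sigma> + g - g) v = u' (\<sigma> + g - g) v" by metis
        then show "u \<sigma> v = u' \<sigma> v" by simp
      qed
    qed
  qed
qed

lemma END_graded_algebra: "graded_algebra (END scale V)"
proof -
  interpret E: direct_sum_of_subspaces "alg_scale (END scale V)" "alg_component (END scale V)"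
    by (rule END_direct)
  have one: "id \<in> END_component scale V 0"
    by (auto simp: END_component_def linear_id)
  have carrier: "id \<in> alg_carrier (END scale V)"
  proof -
    have "0 \<in> END_component scale V \<sigma>" for \<sigma>
      using E.subspace_0[OF E.subspace_component[of \<sigma>]] by simp
    then show ?thesis
      using one component_subset_sum[of id "END_component scale V" 0] by (simp add: alg_carrier_def)
  qed
  show ?thesis
  proof (unfold_locales, goal_cases)
    case (1 x g y h)
    then have "x ` V (h + i) \<subseteq> V (g + (h + i))" "y ` V i \<subseteq> V (h + i)" for i
      by (auto simp: END_component_def)
    then have "(x \<circ> y) ` V i \<subseteq> V (g + h + i)" for i
      by (fastforce simp: add.assoc)
    with 1 show ?case by (auto simp: END_component_def intro: Vector_Spaces.linear_compose)
  next
    case (4 x y z)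
    interpret Vector_Spaces.linear scale scale x by (rule END_carrier_linear) fact
    show ?case by (simp add: fun_eq_iff add)
  next
    case (6 x y c)
    interpret Vector_Spaces.linear scale scale x by (rule END_carrier_linear) fact
    show ?case by (simp add: fun_eq_iff scale)
  qed (use carrier in \<open>auto simp: fun_eq_iff\<close>)
qed

end

end

theory Submission
  imports Defs
begin

text \<open>
  A graded isomorphism from \<open>W\<close> to \<open>V(\<sigma>)\<close> induces an isomorphism of the endomorphism algebras by
  conjugation: \<open>\<sigma>\<close> acts on degrees from the right, operators move degrees from the left, and so
  the suspension is invisible to the degree of an operator
  (\<open>conjugation_graded_algebra_iso\<close>).

  Conversely, a nonzero vector space is recovered from its endomorphism ring as a minimal left
  ideal. Let \<open>V\<close> be nonzero, and write \<open>l(-) v\<close> for the operator \<open>rank_one scaleV l v\<close>. If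
  \<open>v0\<close> is homogeneous and \<open>l\<close> is a functional concentrated in the degree of \<open>v0\<close> with
  \<open>l v0 = 1\<close>, then \<open>e = l(-) v0\<close> is an idempotent of degree zero and \<open>v \<mapsto> l(-) v\<close> identifies \<open>V\<close>
  with the left ideal generated by \<open>e\<close>; this shifts degrees on the right by minus that of \<open>v0\<close>. A graded
  isomorphism \<open>\<phi>\<close> sends \<open>e\<close> to a nonzero idempotent of degree zero, which fixes some homogeneous
  \<open>w0 \<noteq> 0\<close>. Then \<open>v \<mapsto> \<phi> (l(-) v) w0\<close> is a linear map from \<open>V\<close> to \<open>W\<close> intertwining the action of
  each homogeneous operator \<open>T\<close> with that of \<open>\<phi> T\<close>, and shifting degrees by a constant on the
  right. It is bijective because homogeneous operators of rank one move vectors around freely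
  (\<open>suspension_iso_of_graded_algebra_iso\<close>).

  Everything rests on having enough homogeneous functionals, hence enough homogeneous operators
  of rank one: each nonzero vector is detected by one (\<open>exists_homogeneous_functional\<close>).
\<close>

section \<open>Sums of components\<close>

lemma sum_of_components_cases:
  assumes "v \<in> sum_of_components A"
  obtains u where "is_decomposition A v u"
  using assms by (auto simp: sum_of_components_def)

lemma is_decomposition_sum_superset:
  assumes "is_decomposition A v u" and "finite S" and "{g. u g \<noteq> 0} \<subseteq> S"
  shows "v = sum u S"
proof -
  have "sum u {g. u g \<noteq> 0} = sum u S"
    using assms(2,3) by (intro sum.mono_neutral_left) auto
  then show ?thesis using assms(1) by (simp add: is_decomposition_def)
qed

context direct_sum_of_subspaces
begin

lemma zero_in_component: "0 \<in> A g"
  using subspace_component subspace_0 by blast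

lemma is_decomposition_zero: "is_decomposition A 0 (\<lambda>g. 0)"
  by (simp add: is_decomposition_def zero_in_component)

lemma is_decomposition_add:
  assumes u: "is_decomposition A v u" and w: "is_decomposition A x w"
  shows "is_decomposition A (v + x) (\<lambda>g. u g + w g)"
proof -
  let ?S = "{g. u g \<noteq> 0} \<union> {g. w g \<noteq> 0}"
  have fin: "finite ?S" using u w by (simp add: is_decomposition_def)
  have sub: "{g. u g + w g \<noteq> 0} \<subseteq> ?S" by auto
  have "v + x = (\<Sum>g\<in>?S. u g + w g)"
    using is_decomposition_sum_superset[OF u fin] is_decomposition_sum_superset[OF w fin]
    by (simp add: sum.distrib)
  also have "\<dots> = (\<Sum>g | u g + w g \<noteq> 0. u g + w g)"
    using fin sub by (intro sum.mono_neutral_right) auto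
  finally show ?thesis
    using u w finite_subset[OF sub fin] subspace_add[OF subspace_component]
    unfolding is_decomposition_def by blast
qed

lemma is_decomposition_scale:
  assumes u: "is_decomposition A v u"
  shows "is_decomposition A (scale c v) (\<lambda>g. scale c (u g))"
proof -
  have fin: "finite {g. u g \<noteq> 0}" using u by (simp add: is_decomposition_def)
  have sub: "{g. scale c (u g) \<noteq> 0} \<subseteq> {g. u g \<noteq> 0}" by auto
  have "scale c v = (\<Sum>g | u g \<noteq> 0. scale c (u g))"
    using u by (simp add: is_decomposition_def scale_sum_right)
  also have "\<dots> = (\<Sum>g | scale c (u g) \<noteq> 0. scale c (u g))"
    using fin sub by (intro sum.mono_neutral_right) auto
  finally show ?thesis
    using u finite_subset[OF sub fin] subspace_scale[OF subspace_component]
    unfolding is_decomposition_def by blast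
qed

lemma subspace_sum_of_components: "subspace (sum_of_components A)"
  using is_decomposition_zero is_decomposition_add is_decomposition_scale
  unfolding subspace_def sum_of_components_def by blast

lemma component_in_sum: "x \<in> A g \<Longrightarrow> x \<in> sum_of_components A"
  by (rule component_subset_sum) (auto simp: zero_in_component)

text \<open>Membership in the carrier of an algebra of endomorphisms is reduced by this lemma to the
  homogeneous case. The image of a component of \<open>B\<close> may lie in a component of \<open>A\<close> of another
  degree, as happens for \<open>v \<mapsto> l(-) v\<close>.\<close>
lemma additive_maps_into_sum_of_components:
  assumes f: "additive f" and comp: "\<And>g x. x \<in> B g \<Longrightarrow> f x \<in> sum_of_components A"
    and v: "v \<in> sum_of_components B"
  shows "f v \<in> sum_of_components A"
proof -
  obtain u where u: "is_decomposition B v u" using v by (rule sum_of_components_cases)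
  then have "f v = (\<Sum>g | u g \<noteq> 0. f (u g))"
    using additive.sum[OF f, of u] by (simp add: is_decomposition_def)
  also have "\<dots> \<in> sum_of_components A"
    using u comp by (intro subspace_sum[OF subspace_sum_of_components])
      (auto simp: is_decomposition_def)
  finally show ?thesis .
qed

end

section \<open>Homogeneous functionals and operators of rank one\<close>

definition homogeneous_functional ::
  "('k::field \<Rightarrow> 'a::ab_group_add \<Rightarrow> 'a) \<Rightarrow> ('g::group_add \<Rightarrow> 'a set) \<Rightarrow> 'g \<Rightarrow> ('a \<Rightarrow> 'k) \<Rightarrow> bool"
  where "homogeneous_functional scale V g l \<longleftrightarrow>
    Vector_Spaces.linear scale (*) l \<and> (\<forall>h. h \<noteq> g \<longrightarrow> (\<forall>x\<in>V h. l x = 0))"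

definition rank_one :: "('k \<Rightarrow> 'a \<Rightarrow> 'a) \<Rightarrow> ('a \<Rightarrow> 'k) \<Rightarrow> 'a \<Rightarrow> 'a \<Rightarrow> 'a"
  where "rank_one scale l v = (\<lambda>x. scale (l x) v)"

context graded_vector_space
begin

text \<open>Over a field some functional is nonzero on a nonzero component of \<open>v\<close>; composed
  with the projection onto that component it becomes homogeneous and takes that value at \<open>v\<close>.\<close>
lemma exists_homogeneous_functional:
  assumes "v \<noteq> 0"
  obtains g l where "homogeneous_functional scale V g l" and "l v = 1"
proof -
  define c where "c x = (SOME u. is_decomposition V x u)" for x
  have c: "is_decomposition V x (c x)" for x
  proof -
    have "x \<in> sum_of_components V" by (simp add: sum_of_components_UNIV)
    then have "\<exists>u. is_decomposition V x u" by (simp add: sum_of_components_def)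
    then show ?thesis unfolding c_def by (rule someI_ex)
  qed
  have c_eq: "is_decomposition V x u \<Longrightarrow> c x = u" for x u
    using c decomposition_unique by blast
  have c_add: "c (x + y) g = c x g + c y g" for x y g
    using c_eq[OF is_decomposition_add[OF c c]] by simp
  have c_scale: "c (scale a x) g = scale a (c x g)" for a x g
    using c_eq[OF is_decomposition_scale[OF c]] by simp
  have c_other: "c x g = 0" if "x \<in> V h" "h \<noteq> g" for x g h
  proof -
    have "{g. (if g = h then x else 0) \<noteq> 0} = (if x = 0 then {} else {h})" by auto
    then have "is_decomposition V x (\<lambda>g. if g = h then x else 0)"
      using that zero_in_component by (simp add: is_decomposition_def)
    from c_eq[OF this] show ?thesis using that by simp
  qed
  obtain g where g: "c v g \<noteq> 0"
  proof -
    have "v = (\<Sum>g | c v g \<noteq> 0. c v g)" using c[of v] by (simp add: is_decomposition_def)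
    then have "\<exists>g. c v g \<noteq> 0" using assms by (metis sum.neutral)
    then show thesis using that by blast
  qed
  interpret vp: vector_space_pair scale "(*)" by unfold_locales
    (auto simp: algebra_simps)
  have "independent {c v g}" using g by simp
  from vp.linear_independent_extend[OF this, of "\<lambda>_. 1"]
  obtain m where m: "Vector_Spaces.linear scale (*) m" "m (c v g) = 1" by auto
  interpret m: Vector_Spaces.linear scale "(*)" m by fact
  have "Vector_Spaces.linear scale (*) (\<lambda>x. m (c x g))"
    by unfold_locales (auto simp: c_add c_scale m.add m.scale)
  then have "homogeneous_functional scale V g (\<lambda>x. m (c x g))"
    using c_other by (auto simp: homogeneous_functional_def)
  then show thesis using that m(2) by blast
qed

lemma homogeneous_functional_degree:
  assumes "homogeneous_functional scale V g l" and "v \<in> V h" and "l v \<noteq> 0"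
  shows "h = g"
  using assms unfolding homogeneous_functional_def by blast

lemma additive_rank_one: "additive (rank_one scale l)"
  by unfold_locales (simp add: rank_one_def fun_eq_iff scale_right_distrib)

text \<open>The group law need not be commutative: an operator of degree \<open>\<sigma>\<close> shifts on the left,
  so carrying degree \<open>g\<close> to degree \<open>h\<close> requires \<open>\<sigma> = h - g\<close>.\<close>
lemma rank_one_homogeneous:
  assumes l: "homogeneous_functional scale V g l" and v: "v \<in> V h"
  shows "rank_one scale l v \<in> END_component scale V (h - g)"
proof -
  interpret l: Vector_Spaces.linear scale "(*)" l
    using l by (simp add: homogeneous_functional_def)
  have "Vector_Spaces.linear scale scale (rank_one scale l v)"
    by unfold_locales (auto simp: rank_one_def l.add l.scale scale_left_distrib)
  moreover have "rank_one scale l v x \<in> V (h - g + i)" if "x \<in> V i" for x i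
  proof (cases "i = g")
    case True
    then show ?thesis using v subspace_scale[OF subspace_component] by (simp add: rank_one_def)
  next
    case False
    then have "l x = 0" using l that by (auto simp: homogeneous_functional_def)
    then show ?thesis by (simp add: rank_one_def zero_in_component)
  qed
  ultimately show ?thesis by (auto simp: END_component_def)
qed

lemma END_component_in_carrier:
  assumes "f \<in> END_component scale V \<tau>"
  shows "f \<in> alg_carrier (END scale V)"
proof -
  interpret E: direct_sum_of_subspaces "alg_scale (END scale V)" "alg_component (END scale V)"
    by (rule END_direct)
  show ?thesis using E.component_in_sum assms by (simp add: alg_carrier_def)
qed

lemma rank_one_in_carrier:
  assumes "homogeneous_functional scale V g l"
  shows "rank_one scale l v \<in> alg_carrier (END scale V)"
proof -
  interpret E: direct_sum_of_subspaces "alg_scale (END scale V)" "alg_component (END scale V)"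
    by (rule END_direct)
  show ?thesis
    unfolding alg_carrier_def
  proof (rule E.additive_maps_into_sum_of_components[OF additive_rank_one, of V])
    show "v \<in> sum_of_components V" by (simp add: sum_of_components_UNIV)
    fix h x assume "x \<in> V h"
    then show "rank_one scale l x \<in> sum_of_components (alg_component (END scale V))"
      using END_component_in_carrier rank_one_homogeneous[OF assms]
      unfolding alg_carrier_def by blast
  qed
qed

end

section \<open>Graded isomorphisms up to suspension\<close>

lemma graded_vector_space_iso_inv:
  assumes "graded_vector_space_iso scaleW W scaleV (suspension V \<sigma>) f"
  shows "graded_vector_space_iso scaleV V scaleW (suspension W (- \<sigma>)) (inv f)"
proof -
  have f: "Vector_Spaces.linear scaleW scaleV f" "bij f" "\<And>g. f ` W g = V (g + \<sigma>)"
    using assms by (auto simp: graded_vector_space_iso_def suspension_def)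
  interpret f: Vector_Spaces.linear scaleW scaleV f by fact
  have lin: "Vector_Spaces.linear scaleV scaleW (inv f)"
  proof unfold_locales
    show "inv f (x + y) = inv f x + inv f y" for x y
      using f(2) by (intro inv_f_eq) (auto simp: f.add bij_is_inj surj_f_inv_f bij_is_surj)
    show "inv f (scaleV c x) = scaleW c (inv f x)" for c x
      using f(2) by (intro inv_f_eq) (auto simp: f.scale bij_is_inj surj_f_inv_f bij_is_surj)
  qed
  have "inv f ` V g = W (g + - \<sigma>)" for g
  proof -
    have "V g = f ` W (g + - \<sigma>)" using f(3)[of "g + - \<sigma>"] by (simp add: add.assoc)
    then show ?thesis using f(2) by (simp add: image_inv_f_f bij_is_inj)
  qed
  with lin f(2) show ?thesis
    by (auto simp: graded_vector_space_iso_def suspension_def bij_imp_bij_inv)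
qed

text \<open>The suspension shifts degrees on the right and operators shift them on the left. These
  shifts commute, so conjugation preserves the degree of an operator exactly.\<close>
lemma conjugation_END_component:
  assumes iso: "graded_vector_space_iso scaleW W scaleV (suspension V \<sigma>) f"
    and h: "h \<in> END_component scaleV V \<tau>"
  shows "inv f \<circ> h \<circ> f \<in> END_component scaleW W \<tau>"
proof -
  have f: "Vector_Spaces.linear scaleW scaleV f" "\<And>g. f ` W g = V (g + \<sigma>)"
    using iso by (auto simp: graded_vector_space_iso_def suspension_def)
  have f': "Vector_Spaces.linear scaleV scaleW (inv f)" "\<And>g. inv f ` V g = W (g + - \<sigma>)"
    using graded_vector_space_iso_inv[OF iso]
    by (auto simp: graded_vector_space_iso_def suspension_def)
  have hV: "h ` V g \<subseteq> V (\<tau> + g)" for g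
    using h by (simp add: END_component_def)
  have "(inv f \<circ> h \<circ> f) ` W g \<subseteq> W (\<tau> + g)" for g
  proof -
    have "(inv f \<circ> h \<circ> f) ` W g = inv f ` h ` V (g + \<sigma>)"
      by (simp only: image_comp[symmetric] f(2))
    also have "\<dots> \<subseteq> inv f ` V (\<tau> + (g + \<sigma>))" using hV by blast
    also have "\<dots> = W (\<tau> + g)" by (simp add: f'(2) add.assoc[symmetric])
    finally show ?thesis .
  qed
  moreover have "Vector_Spaces.linear scaleW scaleW (inv f \<circ> h \<circ> f)"
    using f(1) f'(1) h by (auto simp: END_component_def intro!: Vector_Spaces.linear_compose)
  ultimately show ?thesis by (simp add: END_component_def)
qed

lemma conjugation_carrier:
  assumes "graded_vector_space scaleW W"
    and iso: "graded_vector_space_iso scaleW W scaleV (suspension V \<sigma>) f"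
    and h: "h \<in> alg_carrier (END scaleV V)"
  shows "inv f \<circ> h \<circ> f \<in> alg_carrier (END scaleW W)"
proof -
  interpret W: graded_vector_space scaleW W by fact
  interpret E: direct_sum_of_subspaces "alg_scale (END scaleW W)" "alg_component (END scaleW W)"
    by (rule W.END_direct)
  interpret f': Vector_Spaces.linear scaleV scaleW "inv f"
    using graded_vector_space_iso_inv[OF iso] by (simp add: graded_vector_space_iso_def)
  have "additive (\<lambda>h. inv f \<circ> h \<circ> f)"
    by unfold_locales (simp add: fun_eq_iff f'.add)
  then show ?thesis
    unfolding alg_carrier_def
  proof (rule E.additive_maps_into_sum_of_components)
    show "h \<in> sum_of_components (END_component scaleV V)" using h by (simp add: alg_carrier_def)
    show "inv f \<circ> x \<circ> f \<in> sum_of_components (alg_component (END scaleW W))"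
      if "x \<in> END_component scaleV V \<tau>" for \<tau> x
      using W.END_component_in_carrier[OF conjugation_END_component[OF iso that]]
      by (simp add: alg_carrier_def)
  qed
qed

lemma conjugation_graded_algebra_iso:
  assumes V: "graded_vector_space scaleV V" and W: "graded_vector_space scaleW W"
    and iso: "graded_vector_space_iso scaleW W scaleV (suspension V \<sigma>) f"
  shows "graded_algebra_iso (END scaleV V) (END scaleW W) (\<lambda>h. inv f \<circ> h \<circ> f)"
proof -
  have bij: "bij f" using iso by (simp add: graded_vector_space_iso_def)
  have inv_inv: "inv (inv f) = f" using bij by (rule inv_inv_eq)
  have ff [simp]: "f (inv f x) = x" "inv f (f y) = y" for x y
    using bij by (auto simp: bij_is_surj surj_f_inv_f bij_is_inj)
  note iso' = graded_vector_space_iso_inv[OF iso]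
  interpret f': Vector_Spaces.linear scaleV scaleW "inv f"
    using iso' by (simp add: graded_vector_space_iso_def)
  have carrier': "f \<circ> h \<circ> inv f \<in> alg_carrier (END scaleV V)"
    if "h \<in> alg_carrier (END scaleW W)" for h
    using conjugation_carrier[OF V iso' that] by (simp add: inv_inv)
  have comp': "f \<circ> h \<circ> inv f \<in> END_component scaleV V \<tau>"
    if "h \<in> END_component scaleW W \<tau>" for h \<tau>
    using conjugation_END_component[OF iso' that] by (simp add: inv_inv)
  have "bij_betw (\<lambda>h. inv f \<circ> h \<circ> f) (alg_carrier (END scaleV V)) (alg_carrier (END scaleW W))"
    using conjugation_carrier[OF W iso] carrier'
    by (intro bij_betw_byWitness[where f' = "\<lambda>h. f \<circ> h \<circ> inv f"]) (auto simp: fun_eq_iff)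
  moreover have "(\<lambda>h. inv f \<circ> h \<circ> f) ` END_component scaleV V \<tau> = END_component scaleW W \<tau>" for \<tau>
  proof
    show "(\<lambda>h. inv f \<circ> h \<circ> f) ` END_component scaleV V \<tau> \<subseteq> END_component scaleW W \<tau>"
      using conjugation_END_component[OF iso] by blast
    show "END_component scaleW W \<tau> \<subseteq> (\<lambda>h. inv f \<circ> h \<circ> f) ` END_component scaleV V \<tau>"
    proof
      fix h assume "h \<in> END_component scaleW W \<tau>"
      then show "h \<in> (\<lambda>h. inv f \<circ> h \<circ> f) ` END_component scaleV V \<tau>"
        by (intro image_eqI[OF _ comp']) (auto simp: fun_eq_iff)
    qed
  qed
  ultimately show ?thesis
    by (auto simp: graded_algebra_iso_def fun_eq_iff f'.add f'.scale)
qed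

section \<open>Recovering the graded vector space from its endomorphism algebra\<close>

text \<open>Here \<open>f v = \<phi> (l(-) v) w0\<close> satisfies \<open>f (T v) = \<phi> T (f v)\<close> for homogeneous \<open>T\<close>, because
  \<open>T \<circ> l(-) v = l(-) (T v)\<close>. Injectivity moves a vector of the kernel to \<open>v0\<close> by an operator on
  \<open>V\<close>; surjectivity moves \<open>w0 = f v0\<close> to a given homogeneous vector by an operator on \<open>W\<close> and
  pulls this operator back along \<open>\<phi>\<close>. The latter also controls the degree of the preimage, so
  \<open>f\<close> maps each component of \<open>V\<close> onto one of \<open>W\<close>.\<close>
lemma suspension_iso_of_graded_algebra_iso:
  fixes scaleV :: "'k::field \<Rightarrow> 'v::ab_group_add \<Rightarrow> 'v"
    and scaleW :: "'k \<Rightarrow> 'w::ab_group_add \<Rightarrow> 'w"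
    and V :: "'g::group_add \<Rightarrow> 'v set" and W :: "'g \<Rightarrow> 'w set"
  assumes "graded_vector_space scaleV V" and "graded_vector_space scaleW W"
    and iso: "graded_algebra_iso (END scaleV V) (END scaleW W) \<phi>"
  obtains \<sigma> f where "graded_vector_space_iso scaleV V scaleW (suspension W \<sigma>) f"
proof -
  interpret V: graded_vector_space scaleV V by fact
  interpret W: graded_vector_space scaleW W by fact
  let ?R = "alg_carrier (END scaleV V)"
  have \<phi>_inj: "inj_on \<phi> ?R"
    and \<phi>_add: "\<And>x y. x \<in> ?R \<Longrightarrow> y \<in> ?R \<Longrightarrow> \<phi> (x + y) = \<phi> x + \<phi> y"
    and \<phi>_scale: "\<And>c x. x \<in> ?R \<Longrightarrow> \<phi> (\<lambda>a. scaleV c (x a)) = (\<lambda>a. scaleW c (\<phi> x a))"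
    and \<phi>_mult: "\<And>x y. x \<in> ?R \<Longrightarrow> y \<in> ?R \<Longrightarrow> \<phi> (x \<circ> y) = \<phi> x \<circ> \<phi> y"
    and \<phi>_one: "\<phi> id = id"
    and \<phi>_comp: "\<And>g. \<phi> ` END_component scaleV V g = END_component scaleW W g"
    using iso by (auto simp: graded_algebra_iso_def bij_betw_def)
  have zero_END: "0 \<in> END_component scaleV V g" for g
  proof -
    interpret E: direct_sum_of_subspaces "alg_scale (END scaleV V)" "alg_component (END scaleV V)"
      by (rule V.END_direct)
    show ?thesis using E.zero_in_component[of g] by simp
  qed
  have zero_R: "0 \<in> ?R" using zero_END V.END_component_in_carrier by blast
  have \<phi>_zero: "\<phi> 0 = 0" using \<phi>_add[OF zero_R zero_R] by simp
  have \<phi>_linear: "Vector_Spaces.linear scaleW scaleW (\<phi> T)" and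
       \<phi>_degree: "\<And>g x. x \<in> W g \<Longrightarrow> \<phi> T x \<in> W (\<tau> + g)"
    if "T \<in> END_component scaleV V \<tau>" for T \<tau>
  proof -
    have "\<phi> T \<in> END_component scaleW W \<tau>" using \<phi>_comp that by blast
    then show "Vector_Spaces.linear scaleW scaleW (\<phi> T)" "\<And>g x. x \<in> W g \<Longrightarrow> \<phi> T x \<in> W (\<tau> + g)"
      by (auto simp: END_component_def)
  qed
  show thesis
  proof (cases "\<exists>g. \<exists>v\<in>V g. v \<noteq> 0")
    case False
    \<comment> \<open>Here \<open>V\<close> vanishes, hence so does \<open>W\<close>, because \<open>id = 0\<close> passes from one algebra to the other.\<close>
    have V0: "v = 0" for v :: 'v
    proof -
      obtain u where "is_decomposition V v u"
        using V.sum_of_components_UNIV by (auto simp: sum_of_components_def)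
      with False show ?thesis by (simp add: is_decomposition_def) (metis sum.neutral)
    qed
    have "(id :: 'v \<Rightarrow> 'v) = 0" by (rule ext) (metis V0)
    with \<phi>_one \<phi>_zero have "(id :: 'w \<Rightarrow> 'w) = 0" by simp
    then have W0: "w = 0" for w :: 'w by (metis id_apply zero_fun_apply)
    have Vg: "V g = {0}" for g using V.zero_in_component[of g] V0 by auto
    have Wg: "W g = {0}" for g using W.zero_in_component[of g] W0 by auto
    have "Vector_Spaces.linear scaleV scaleW (\<lambda>_. 0)"
      by unfold_locales auto
    moreover have "bij (\<lambda>_::'v. 0::'w)"
    proof (rule bijI)
      show "inj (\<lambda>_::'v. 0::'w)" by (rule injI) (metis V0)
      show "surj (\<lambda>_::'v. 0::'w)" by (rule surjI[where f = "\<lambda>_. 0"]) (metis W0)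
    qed
    ultimately have "graded_vector_space_iso scaleV V scaleW (suspension W 0) (\<lambda>_. 0)"
      by (simp add: graded_vector_space_iso_def suspension_def Vg Wg)
    then show thesis by (rule that)
  next
    case True
    then obtain a v0 where v0: "v0 \<in> V a" "v0 \<noteq> 0" by blast
    obtain a' l where l': "homogeneous_functional scaleV V a' l" and lv0: "l v0 = 1"
      using V.exists_homogeneous_functional[OF v0(2)] by blast
    have "a = a'" using V.homogeneous_functional_degree[OF l' v0(1)] lv0 by simp
    with l' have l: "homogeneous_functional scaleV V a l" by simp
    define e where "e = rank_one scaleV l v0"
    have e_END: "e \<in> END_component scaleV V 0"
      using V.rank_one_homogeneous[OF l v0(1)] by (simp add: e_def)
    then have e_R: "e \<in> ?R" by (rule V.END_component_in_carrier)
    have e_idem: "e \<circ> e = e" and "e v0 = v0"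
    proof -
      interpret l: Vector_Spaces.linear scaleV "(*)" l
        using l by (simp add: homogeneous_functional_def)
      show "e \<circ> e = e" "e v0 = v0"
        by (simp_all add: e_def rank_one_def fun_eq_iff l.scale lv0)
    qed
    with v0 have "e \<noteq> 0" by auto
    then have "\<phi> e \<noteq> 0" using \<phi>_inj e_R zero_R \<phi>_zero by (metis inj_onD)
    have "\<exists>b. \<exists>w\<in>W b. \<phi> e w \<noteq> 0"
    proof (rule ccontr)
      assume "\<not> ?thesis"
      then have "\<phi> e = \<phi> 0"
        using \<phi>_linear[OF e_END] \<phi>_linear[OF zero_END]
        by (intro W.linear_eqI) (auto simp: \<phi>_zero)
      with \<open>\<phi> e \<noteq> 0\<close> \<phi>_zero show False by simp
    qed
    then obtain b w1 where w1: "w1 \<in> W b" "\<phi> e w1 \<noteq> 0" by blast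
    define w0 where "w0 = \<phi> e w1"
    have w0: "w0 \<in> W b" "w0 \<noteq> 0"
      using \<phi>_degree[OF e_END w1(1)] w1(2) by (auto simp: w0_def)
    have e_w0: "\<phi> e w0 = w0"
    proof -
      have "\<phi> e \<circ> \<phi> e = \<phi> e" using \<phi>_mult[OF e_R e_R] by (simp add: e_idem)
      from fun_cong[OF this, of w1] show ?thesis by (simp add: w0_def)
    qed
    define f where "f v = \<phi> (rank_one scaleV l v) w0" for v
    have r_R: "rank_one scaleV l v \<in> ?R" for v
      by (rule V.rank_one_in_carrier[OF l])
    have f_linear: "Vector_Spaces.linear scaleV scaleW f"
    proof unfold_locales
      show "f (x + y) = f x + f y" for x y
        unfolding f_def additive.add[OF V.additive_rank_one] \<phi>_add[OF r_R r_R] by simp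
      have "rank_one scaleV l (scaleV c x) = (\<lambda>y. scaleV c (rank_one scaleV l x y))" for c x
        by (simp add: rank_one_def fun_eq_iff mult.commute)
      then show "f (scaleV c x) = scaleW c (f x)" for c x
        by (simp add: f_def \<phi>_scale[OF r_R])
    qed
    interpret f: Vector_Spaces.linear scaleV scaleW f by (rule f_linear)
    have f_v0: "f v0 = w0" using e_w0 by (simp add: f_def e_def)
    have f_intertwines: "f (T v) = \<phi> T (f v)" if T: "T \<in> END_component scaleV V \<tau>" for T v \<tau>
    proof -
      interpret T: Vector_Spaces.linear scaleV scaleV T
        using T by (simp add: END_component_def)
      have "rank_one scaleV l (T v) = T \<circ> rank_one scaleV l v"
        by (simp add: rank_one_def fun_eq_iff T.scale)
      then show ?thesis
        using \<phi>_mult[OF V.END_component_in_carrier[OF T] r_R] by (simp add: f_def)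
    qed
    have f_degree: "f v \<in> W (g - a + b)" if "v \<in> V g" for v g
      using \<phi>_degree[OF V.rank_one_homogeneous[OF l that] w0(1)] by (simp add: f_def)
    obtain b' m where m': "homogeneous_functional scaleW W b' m" and mw0: "m w0 = 1"
      using W.exists_homogeneous_functional[OF w0(2)] by blast
    have "b = b'" using W.homogeneous_functional_degree[OF m' w0(1)] mw0 by simp
    with m' have m: "homogeneous_functional scaleW W b m" by simp
    have f_onto: "\<exists>v\<in>V (h - b + a). f v = w" if w: "w \<in> W h" for w h
    proof -
      have "rank_one scaleW m w \<in> \<phi> ` END_component scaleV V (h - b)"
        using W.rank_one_homogeneous[OF m w] \<phi>_comp by simp
      then obtain T where T: "T \<in> END_component scaleV V (h - b)" "\<phi> T = rank_one scaleW m w"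
        by auto
      have "f (T v0) = w"
        using f_intertwines[OF T(1), of v0] by (simp add: f_v0 T(2) rank_one_def mw0)
      moreover have "T v0 \<in> V (h - b + a)" using T(1) v0(1) by (auto simp: END_component_def)
      ultimately show ?thesis by blast
    qed
    have comp: "f ` V g = W (g - a + b)" for g
    proof
      show "f ` V g \<subseteq> W (g - a + b)" using f_degree by blast
      have "g - a + b - b + a = g" by simp
      then show "W (g - a + b) \<subseteq> f ` V g" using f_onto[of _ "g - a + b"] by auto
    qed
    have surj: "surj f"
    proof -
      have "w \<in> range f" for w
      proof -
        obtain u where u: "is_decomposition W w u"
          using W.sum_of_components_UNIV by (auto simp: sum_of_components_def)
        then have "\<forall>h. \<exists>v. f v = u h" using f_onto by (meson is_decomposition_def)
        then obtain x where "\<And>h. f (x h) = u h" by metis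
        then have "w = f (\<Sum>h | u h \<noteq> 0. x h)"
          using u by (simp add: is_decomposition_def f.sum)
        then show ?thesis by blast
      qed
      then show ?thesis by blast
    qed
    \<comment> \<open>Even when \<open>v\<close> is not homogeneous, a homogeneous operator carries it to \<open>v0\<close>.\<close>
    have inj: "v = 0" if "f v = 0" for v
    proof (rule ccontr)
      assume "v \<noteq> 0"
      then obtain c n where n: "homogeneous_functional scaleV V c n" "n v = 1"
        using V.exists_homogeneous_functional by blast
      have T: "rank_one scaleV n v0 \<in> END_component scaleV V (a - c)"
        by (rule V.rank_one_homogeneous[OF n(1) v0(1)])
      interpret T: Vector_Spaces.linear scaleW scaleW "\<phi> (rank_one scaleV n v0)"
        by (rule \<phi>_linear[OF T])
      have "w0 = 0"
      proof -
        have "rank_one scaleV n v0 v = v0" by (simp add: rank_one_def n(2))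
        then have "w0 = \<phi> (rank_one scaleV n v0) (f v)"
          using f_intertwines[OF T, of v] f_v0 by simp
        then show ?thesis by (simp only: that T.zero)
      qed
      with w0(2) show False by simp
    qed
    have "inj f" using inj by (simp add: f.inj_iff_eq_0)
    with surj have "bij f" by (simp add: bij_def)
    moreover have "f ` V g = suspension W (- a + b) g" for g
      using comp[of g] by (simp add: suspension_def add.assoc[symmetric])
    ultimately show thesis
      using f_linear that[of "- a + b" f] by (simp add: graded_vector_space_iso_def)
  qed
qed

theorem theorem3p1:
  fixes scaleV :: "'k::field \<Rightarrow> 'v::ab_group_add \<Rightarrow> 'v"
    and scaleW :: "'k \<Rightarrow> 'w::ab_group_add \<Rightarrow> 'w"
    and V :: "'g::group_add \<Rightarrow> 'v set"
    and W :: "'g \<Rightarrow> 'w set"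
  assumes "graded_vector_space scaleV V" and "finite_dimensional scaleV"
    and "graded_vector_space scaleW W" and "finite_dimensional scaleW"
  shows "graded_algebras_isomorphic (END scaleV V) (END scaleW W) \<longleftrightarrow>
    (\<exists>\<sigma>. graded_vector_spaces_isomorphic scaleW W scaleV (suspension V \<sigma>))"
proof
  assume "graded_algebras_isomorphic (END scaleV V) (END scaleW W)"
  then obtain \<phi> where "graded_algebra_iso (END scaleV V) (END scaleW W) \<phi>"
    by (auto simp: graded_algebras_isomorphic_def)
  then obtain \<sigma> f where "graded_vector_space_iso scaleV V scaleW (suspension W \<sigma>) f"
    using suspension_iso_of_graded_algebra_iso[OF assms(1,3)] by blast
  then have "graded_vector_space_iso scaleW W scaleV (suspension V (- \<sigma>)) (inv f)"
    by (rule graded_vector_space_iso_inv)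
  then show "\<exists>\<sigma>. graded_vector_spaces_isomorphic scaleW W scaleV (suspension V \<sigma>)"
    by (auto simp: graded_vector_spaces_isomorphic_def)
next
  assume "\<exists>\<sigma>. graded_vector_spaces_isomorphic scaleW W scaleV (suspension V \<sigma>)"
  then obtain \<sigma> f where "graded_vector_space_iso scaleW W scaleV (suspension V \<sigma>) f"
    by (auto simp: graded_vector_spaces_isomorphic_def)
  then show "graded_algebras_isomorphic (END scaleV V) (END scaleW W)"
    using conjugation_graded_algebra_iso[OF assms(1,3)] by (auto simp: graded_algebras_isomorphic_def)
qed

end
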